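(* The operator $T(t_1,t_2,r)$ maps an Askey--Wilson polynomial to a similar one: with $x=\cos\theta$, $$\big(T(t_1,t_2,r)\,p_n(\cdot;t_1,t_2,t_3,t_4)\big)(x)=\frac{h(x;t_1,t_2)\,(r^2t_1t_2q^n;q)_\infty}{h(x;t_1r,t_2r)\,(t_1t_2q^n;q)_\infty}\;p_n(x;t_1r,t_2r,t_3/r,t_4/r)\,r^n.$$
   Context: Throughout $0<q<1$, $(A;q)_\infty=\prod_{k\ge0}(1-Aq^k)$, $(A;q)_n=\prod_{k=0}^{n-1}(1-Aq^k)$, $(A_1,\dots,A_m;q)_n=\prod_j(A_j;q)_n$ (also for $n=\infty$), ${}_{4}\phi_3\big({\alpha_1,\dots,\alpha_{4}\atop\beta_1,\beta_2,\beta_3}\big|q,x\big)=\sum_{k\ge0}\frac{(\alpha_1,\dots,\alpha_{4};q)_k}{(q,\beta_1,\beta_2,\beta_3;q)_k}x^k$, and $h(\cos\theta;a_1,\dots,a_n)=\prod_{j=1}^n(a_je^{i\theta},a_je^{-i\theta};q)_\infty$. The Askey--Wilson polynomials, $n=0,1,2,\dots$, are $$p_n(\cos\theta;t_1,t_2,t_3,t_4)=(t_1t_2,t_1t_3,t_1t_4;q)_n\,t_1^{-n}\,{}_4\phi_3\left(\begin{matrix}q^{-n},q^{n-1}t_1t_2t_3t_4,t_1e^{i\theta},t_1e^{-i\theta}\\t_1t_2,t_1t_3,t_1t_4\end{matrix}\Big|q,q\right).$$ With $w_H(x|q)=\frac{(q,e^{2i\theta},e^{-2i\theta};q)_\infty}{2\pi\sqrt{1-x^2}}$,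 $x=\cos\theta$, the operator is, for $-1<r<1$ and $f\in C[-1,1]$, $$(T(a,b,r)f)(\cos\theta)=h(\cos\theta;a,b)\,(r^2;q)_\infty\int_0^\pi\frac{w_H(\cos\phi|q)f(\cos\phi)\sin\phi\,d\phi}{h(\cos\phi;re^{i\theta},re^{-i\theta})\,h(\cos\phi;a,b)}.$$
   Formalization: The formal statement adds the usual condition |t_1|<1, |t_2|<1, without which the identity fails (for |t_1|>1 the Askey–Wilson integral acquires residue terms), and r≠0, needed for t_3/r and t_4/r. *)

theory Defs
  imports "HOL-Analysis.Analysis"
begin

definition qpoch :: "complex \<Rightarrow> real \<Rightarrow> nat \<Rightarrow> complex" where
  "qpoch A q n = (\<Prod>k<n. 1 - A * of_real q ^ k)"

definition qpoch_inf :: "complex \<Rightarrow> real \<Rightarrow> complex" where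
  "qpoch_inf A q = (\<Prod>k. 1 - A * of_real q ^ k)"

definition qpochs :: "complex list \<Rightarrow> real \<Rightarrow> nat \<Rightarrow> complex" where
  "qpochs As q n = (\<Prod>A\<leftarrow>As. qpoch A q n)"

definition qpochs_inf :: "complex list \<Rightarrow> real \<Rightarrow> complex" where
  "qpochs_inf As q = (\<Prod>A\<leftarrow>As. qpoch_inf A q)"

text \<open>
  The basic hypergeometric series with upper parameters \<open>as\<close> and lower parameters \<open>bs\<close>,
  where \<open>length as = length bs + 1\<close>; for other lengths the usual definition carries
  an additional power of \<open>(-1) ^ k * q ^ (k choose 2)\<close>.
\<close>
definition qphi :: "complex list \<Rightarrow> complex list \<Rightarrow> real \<Rightarrow> complex \<Rightarrow> complex" where
  "qphi as bs q x = (\<Sum>k. qpochs as q k / qpochs (of_real q # bs) q k * x ^ k)"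

text \<open>
  Functions of \<open>x = cos \<theta>\<close> are functions of \<open>x \<in> [-1, 1]\<close>, with \<open>\<theta> = arccos x \<in> [0, \<pi>]\<close>.
  Each of the expressions below is unchanged under \<open>\<theta> \<mapsto> -\<theta>\<close> and \<open>\<theta> \<mapsto> \<theta> + 2 \<pi>\<close>, so the
  choice of \<open>\<theta>\<close> is immaterial.
\<close>
definition h :: "real \<Rightarrow> real \<Rightarrow> complex list \<Rightarrow> complex" where
  "h q x as = (let \<theta> = arccos x in \<Prod>a\<leftarrow>as. qpochs_inf [a * cis \<theta>, a * cis (- \<theta>)] q)"

text \<open>
  The defining formula makes sense for \<open>t1 \<noteq> 0\<close> (or \<open>n = 0\<close>) and when none of
  \<open>t1 * t2\<close>, \<open>t1 * t3\<close>, \<open>t1 * t4\<close> is some \<open>q powi (- k)\<close> with \<open>0 \<le> k < n\<close>. In the remaining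
  cases its value here is \<open>0\<close>, and not that of the continuous extension in the parameters.
\<close>
definition askey_wilson ::
    "real \<Rightarrow> nat \<Rightarrow> complex \<Rightarrow> complex \<Rightarrow> complex \<Rightarrow> complex \<Rightarrow> real \<Rightarrow> complex" where
  "askey_wilson q n t1 t2 t3 t4 x =
     (let \<theta> = arccos x in
        qpochs [t1 * t2, t1 * t3, t1 * t4] q n * t1 powi (- int n) *
        qphi [of_real q powi (- int n), of_real q powi (int n - 1) * t1 * t2 * t3 * t4,
              t1 * cis \<theta>, t1 * cis (- \<theta>)]
             [t1 * t2, t1 * t3, t1 * t4] q (of_real q))"

definition w_H :: "real \<Rightarrow> real \<Rightarrow> complex" where
  "w_H q x = (let \<theta> = arccos x in
     qpochs_inf [of_real q, cis (2 * \<theta>), cis (- 2 * \<theta>)] q / of_real (2 * pi * sqrt (1 - x\<^sup>2)))"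

text \<open>At \<open>\<phi> = 0\<close> and \<open>\<phi> = \<pi>\<close> the integrand takes the value \<open>0\<close>, by division by zero.\<close>
definition T_op ::
    "real \<Rightarrow> complex \<Rightarrow> complex \<Rightarrow> real \<Rightarrow> (real \<Rightarrow> complex) \<Rightarrow> real \<Rightarrow> complex" where
  "T_op q a b r f x =
     (let \<theta> = arccos x in
        h q x [a, b] * qpoch_inf (of_real (r\<^sup>2)) q *
        integral {0..pi} (\<lambda>\<phi>.
          w_H q (cos \<phi>) * f (cos \<phi>) * of_real (sin \<phi>) /
          (h q (cos \<phi>) [of_real r * cis \<theta>, of_real r * cis (- \<theta>)] * h q (cos \<phi>) [a, b])))"

end

(*
  In terms of z = exp (i t), the Askey-Wilson weight W satisfies a q-difference equation that turns the
  vanishing of a contour integral over an annulus q <= |z| <= 1 into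
    (1 - a b c d) I(q a, b, c, d) = (1 - a b) (1 - a c) (1 - a d) I(a, b, c, d)
  for I(a, b, c, d), the integral of W over [0, pi].  Iterating this in each parameter expresses
  I(a, b, c, d) by I(0, 0, 0, 0), and the latter is found from one explicit choice of parameters.
  Expanding p_n into its 4-phi-3 sum, the factor (t1 e^(i t), t1 e^(-i t); q)_k replaces t1 by t1 q^k in the
  weight of the kernel, so T acts on each summand by the Askey-Wilson integral with parameters
  r e^(i theta), r e^(-i theta), t1 q^k, t2.
*)
theory Submission
  imports Defs "HOL-Complex_Analysis.Complex_Analysis"
begin

subsection \<open>\<open>q\<close>-Pochhammer symbols\<close>

lemma qpoch_0 [simp]: "qpoch A q 0 = 1"
  by (simp add: qpoch_def)

lemma qpoch_Suc: "qpoch A q (Suc n) = qpoch A q n * (1 - A * of_real q ^ n)"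
  by (simp add: qpoch_def)

lemma qpoch_add: "qpoch A q (m + n) = qpoch A q m * qpoch (A * of_real q ^ m) q n"
  by (induction n) (simp_all add: qpoch_Suc power_add mult_ac)

lemma norm_mult_power_less_one:
  fixes A :: complex
  assumes "\<bar>q\<bar> < 1" "norm A < 1"
  shows "norm (A * of_real q ^ k) < 1"
proof -
  have "norm A * \<bar>q\<bar> ^ k \<le> norm A"
    by (rule mult_left_le) (use assms in \<open>auto intro: power_le_one\<close>)
  with assms(2) show ?thesis
    by (simp add: norm_mult norm_power)
qed

lemma one_minus_mult_power_nonzero:
  fixes A :: complex
  assumes "\<bar>q\<bar> < 1" "norm A < 1"
  shows "1 - A * of_real q ^ k \<noteq> 0"
proof
  assume "1 - A * of_real q ^ k = 0"
  hence "A * of_real q ^ k = 1"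
    by simp
  with norm_mult_power_less_one[OF assms, of k] show False
    by simp
qed

lemma qpoch_nonzero:
  assumes "\<bar>q\<bar> < 1" "norm A < 1"
  shows "qpoch A q n \<noteq> 0"
  using one_minus_mult_power_nonzero[OF assms] by (simp add: qpoch_def)

lemma convergent_prod_qpoch:
  assumes "\<bar>q\<bar> < 1"
  shows "convergent_prod (\<lambda>k. 1 - A * complex_of_real q ^ k)"
proof (rule abs_convergent_prod_imp_convergent_prod)
  have "summable (\<lambda>k. norm A * \<bar>q\<bar> ^ k)"
    using assms by (intro summable_mult summable_geometric) auto
  thus "abs_convergent_prod (\<lambda>k. 1 - A * complex_of_real q ^ k)"
    unfolding abs_convergent_prod_conv_summable by (simp add: norm_mult norm_power)
qed

lemma qpoch_tendsto_qpoch_inf: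
  assumes "\<bar>q\<bar> < 1"
  shows "(\<lambda>n. qpoch A q n) \<longlonglongrightarrow> qpoch_inf A q"
proof -
  have "(\<lambda>n. qpoch A q (Suc n)) \<longlonglongrightarrow> qpoch_inf A q"
    using convergent_prod_LIMSEQ[OF convergent_prod_qpoch[OF assms, of A]]
    by (simp add: qpoch_def qpoch_inf_def lessThan_Suc_atMost)
  thus ?thesis
    by (simp add: filterlim_sequentially_Suc)
qed

lemma qpoch_inf_split:
  assumes "\<bar>q\<bar> < 1"
  shows "qpoch_inf A q = qpoch A q n * qpoch_inf (A * of_real q ^ n) q"
proof (rule LIMSEQ_unique)
  show "(\<lambda>m. qpoch A q (n + m)) \<longlonglongrightarrow> qpoch_inf A q"
    using LIMSEQ_ignore_initial_segment[OF qpoch_tendsto_qpoch_inf[OF assms], of A n]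
    by (simp add: add.commute)
  show "(\<lambda>m. qpoch A q (n + m)) \<longlonglongrightarrow> qpoch A q n * qpoch_inf (A * of_real q ^ n) q"
    unfolding qpoch_add by (intro tendsto_mult tendsto_const qpoch_tendsto_qpoch_inf assms)
qed

lemma qpoch_inf_split_head:
  assumes "\<bar>q\<bar> < 1"
  shows "qpoch_inf A q = (1 - A) * qpoch_inf (A * of_real q) q"
  using qpoch_inf_split[OF assms, of A 1] by (simp add: qpoch_Suc)

lemma qpoch_inf_nonzero:
  assumes "\<bar>q\<bar> < 1" "norm A < 1"
  shows "qpoch_inf A q \<noteq> 0"
  unfolding qpoch_inf_def
  by (rule prodinf_nonzero[OF convergent_prod_qpoch[OF assms(1)]])
     (rule one_minus_mult_power_nonzero[OF assms])

lemma qpoch_inf_0 [simp]: "qpoch_inf 0 q = 1"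
  by (simp add: qpoch_inf_def)

lemma qpoch_inf_1:
  assumes "\<bar>q\<bar> < 1"
  shows "qpoch_inf 1 q = 0"
  by (subst qpoch_inf_split_head[OF assms]) simp

lemma qpoch_inf_mult_uminus:
  assumes "\<bar>q\<bar> < 1"
  shows "qpoch_inf A q * qpoch_inf (- A) q = qpoch_inf (A ^ 2) (q ^ 2)"
proof (rule LIMSEQ_unique)
  show "(\<lambda>n. qpoch A q n * qpoch (- A) q n) \<longlonglongrightarrow> qpoch_inf A q * qpoch_inf (- A) q"
    by (intro tendsto_mult qpoch_tendsto_qpoch_inf assms)
  have "qpoch A q n * qpoch (- A) q n = qpoch (A ^ 2) (q ^ 2) n" for n
    by (induction n) (simp_all add: qpoch_Suc algebra_simps power2_eq_square power_mult_distrib)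
  moreover have "\<bar>q ^ 2\<bar> < 1"
    using assms by (simp add: abs_square_less_1)
  ultimately show "(\<lambda>n. qpoch A q n * qpoch (- A) q n) \<longlonglongrightarrow> qpoch_inf (A ^ 2) (q ^ 2)"
    by (simp add: qpoch_tendsto_qpoch_inf)
qed

lemma qpoch_inf_mult_even_odd:
  assumes "\<bar>q\<bar> < 1"
  shows "qpoch_inf A (q ^ 2) * qpoch_inf (A * of_real q) (q ^ 2) = qpoch_inf A q"
proof (rule LIMSEQ_unique)
  have "\<bar>q ^ 2\<bar> < 1"
    using assms by (simp add: abs_square_less_1)
  thus "(\<lambda>n. qpoch A (q ^ 2) n * qpoch (A * of_real q) (q ^ 2) n)
          \<longlonglongrightarrow> qpoch_inf A (q ^ 2) * qpoch_inf (A * of_real q) (q ^ 2)"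
    by (intro tendsto_mult qpoch_tendsto_qpoch_inf)
  have "qpoch A (q ^ 2) n * qpoch (A * of_real q) (q ^ 2) n = qpoch A q (2 * n)" for n
  proof (induction n)
    case (Suc n)
    have pow: "complex_of_real (q ^ 2) ^ n = of_real q ^ (2 * n)"
      by (simp add: power_mult)
    have "qpoch A (q ^ 2) (Suc n) * qpoch (A * of_real q) (q ^ 2) (Suc n) =
      (qpoch A (q ^ 2) n * qpoch (A * of_real q) (q ^ 2) n) *
      ((1 - A * of_real q ^ (2 * n)) * (1 - A * of_real q ^ Suc (2 * n)))"
      by (simp only: qpoch_Suc pow power_Suc mult_ac)
    also have "\<dots> = qpoch A q (2 * Suc n)"
      unfolding Suc.IH by (simp add: qpoch_Suc)
    finally show ?case .
  qed simp
  moreover have "(\<lambda>n. qpoch A q (2 * n)) \<longlonglongrightarrow> qpoch_inf A q"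
    using LIMSEQ_subseq_LIMSEQ[OF qpoch_tendsto_qpoch_inf[OF assms], of "\<lambda>n. 2 * n" A]
    by (simp add: strict_mono_def o_def)
  ultimately show "(\<lambda>n. qpoch A (q ^ 2) n * qpoch (A * of_real q) (q ^ 2) n) \<longlonglongrightarrow> qpoch_inf A q"
    by simp
qed

lemma uniform_limit_qpoch_inf:
  assumes "\<bar>q\<bar> < 1"
  shows "uniform_limit (cball 0 R) (\<lambda>n A. qpoch A q n) (\<lambda>A. qpoch_inf A q) sequentially"
proof -
  have "uniformly_convergent_on (cball 0 R) (\<lambda>n A. \<Prod>k<n. 1 - A * complex_of_real q ^ k)"
  proof (rule uniformly_convergent_on_prod')
    show "uniformly_convergent_on (cball 0 R)
            (\<lambda>N A. \<Sum>n<N. norm (1 - A * complex_of_real q ^ n - 1))"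
    proof (rule Weierstrass_m_test')
      show "summable (\<lambda>n. R * \<bar>q\<bar> ^ n)"
        using assms by (intro summable_mult summable_geometric) auto
    qed (auto simp: norm_mult norm_power intro!: mult_right_mono)
  qed (auto intro!: continuous_intros)
  then obtain g where g: "uniform_limit (cball 0 R) (\<lambda>n A. qpoch A q n) g sequentially"
    unfolding uniformly_convergent_on_def qpoch_def by blast
  have "g A = qpoch_inf A q" if "A \<in> cball 0 R" for A
    using tendsto_uniform_limitI[OF g that] qpoch_tendsto_qpoch_inf[OF assms] LIMSEQ_unique by blast
  thus ?thesis
    using g by (subst (asm) uniform_limit_cong') auto
qed

lemma holomorphic_qpoch_inf:
  assumes "\<bar>q\<bar> < 1"
  shows "(\<lambda>A. qpoch_inf A q) holomorphic_on UNIV"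
proof (rule holomorphic_uniform_sequence)
  fix z :: complex
  have "uniform_limit (cball z 1) (\<lambda>n A. qpoch A q n) (\<lambda>A. qpoch_inf A q) sequentially"
    by (rule uniform_limit_on_subset[OF uniform_limit_qpoch_inf[OF assms, of "norm z + 1"]])
       (simp add: cball_subset_cball_iff)
  thus "\<exists>d>0. cball z d \<subseteq> UNIV \<and>
          uniform_limit (cball z d) (\<lambda>n A. qpoch A q n) (\<lambda>A. qpoch_inf A q) sequentially"
    by (intro exI[of _ 1]) auto
qed (auto simp: qpoch_def intro!: holomorphic_intros)

lemma holomorphic_on_qpoch_inf [holomorphic_intros]:
  assumes "\<bar>q\<bar> < 1" "f holomorphic_on S"
  shows "(\<lambda>z. qpoch_inf (f z) q) holomorphic_on S"
  using holomorphic_on_compose[OF assms(2) holomorphic_on_subset[OF holomorphic_qpoch_inf[OF assms(1)]]]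
  by (simp add: o_def)

lemma continuous_on_qpoch_inf [continuous_intros]:
  assumes "\<bar>q\<bar> < 1" "continuous_on S f"
  shows "continuous_on S (\<lambda>z. qpoch_inf (f z) q)"
  using continuous_on_compose2[OF holomorphic_on_imp_continuous_on[OF holomorphic_qpoch_inf[OF assms(1)]] assms(2)]
  by simp

subsection \<open>The Askey--Wilson integral\<close>

lemma integral_circle_annulus:
  fixes f :: "complex \<Rightarrow> complex"
  assumes "0 < r" "r \<le> s" and S: "open S" "f holomorphic_on S"
    and sub: "{z. r \<le> norm z \<and> norm z \<le> s} \<subseteq> S"
  shows "integral {-pi..pi} (\<lambda>t. f (s * cis t) * (s * cis t)) =
         integral {-pi..pi} (\<lambda>t. f (r * cis t) * (r * cis t))"
proof -
  have eq: "contour_integral (part_circlepath 0 \<rho> (-pi) pi) f =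
      \<i> * integral {-pi..pi} (\<lambda>t. f (\<rho> * cis t) * (\<rho> * cis t))" for \<rho> :: real
    by (subst contour_integral_part_circlepath_eq) (simp_all add: mult_ac flip: integral_mult_right)
  have "homotopic_loops S (part_circlepath 0 s (-pi) pi) (part_circlepath 0 r (-pi) pi)"
  proof (rule homotopic_loops_linear)
    fix t :: real
    let ?e = "exp (\<i> * of_real (linepath (-pi) pi t))"
    show "closed_segment (part_circlepath 0 s (-pi) pi t) (part_circlepath 0 r (-pi) pi t) \<subseteq> S"
    proof
      fix z assume "z \<in> closed_segment (part_circlepath 0 s (-pi) pi t) (part_circlepath 0 r (-pi) pi t)"
      then obtain u where u: "0 \<le> u" "u \<le> 1" "z = (1 - u) *\<^sub>R (s * ?e) + u *\<^sub>R (r * ?e)"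
        by (auto simp: closed_segment_def part_circlepath_def)
      define \<rho> where "\<rho> = (1 - u) * s + u * r"
      have "z = of_real \<rho> * ?e"
        by (simp add: u(3) \<rho>_def scaleR_conv_of_real algebra_simps)
      hence "norm z = \<bar>\<rho>\<bar>"
        by (simp add: norm_mult)
      moreover have "s - \<rho> = u * (s - r)" "\<rho> - r = (1 - u) * (s - r)"
        by (simp_all add: \<rho>_def algebra_simps)
      hence "r \<le> \<rho>" "\<rho> \<le> s"
        using u assms by (metis diff_ge_0_iff_ge mult_nonneg_nonneg)+
      ultimately show "z \<in> S"
        using sub assms by auto
    qed
  qed (use cis_pi in \<open>auto simp: exp_eq_polar path_part_circlepath complex_eq_iff\<close>)
  hence "contour_integral (part_circlepath 0 s (-pi) pi) f = contour_integral (part_circlepath 0 r (-pi) pi) f"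
    by (rule Cauchy_theorem_homotopic_loops) (use S in auto)
  thus ?thesis
    by (simp add: eq)
qed

definition aw_factor :: "real \<Rightarrow> complex \<Rightarrow> real \<Rightarrow> complex" where
  "aw_factor q e t = qpoch_inf (e * cis t) q * qpoch_inf (e * cis (- t)) q"

definition aw_weight :: "real \<Rightarrow> complex \<Rightarrow> complex \<Rightarrow> complex \<Rightarrow> complex \<Rightarrow> real \<Rightarrow> complex" where
  "aw_weight q a b c d t = qpoch_inf (cis (2 * t)) q * qpoch_inf (cis (- 2 * t)) q /
     (aw_factor q a t * aw_factor q b t * aw_factor q c t * aw_factor q d t)"

definition aw_integral :: "real \<Rightarrow> complex \<Rightarrow> complex \<Rightarrow> complex \<Rightarrow> complex \<Rightarrow> complex" where
  "aw_integral q a b c d = integral {0..pi} (aw_weight q a b c d)"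

lemma aw_factor_nonzero:
  assumes "\<bar>q\<bar> < 1" "norm e < 1"
  shows "aw_factor q e t \<noteq> 0"
  unfolding aw_factor_def using assms by (simp add: qpoch_inf_nonzero norm_mult)

lemma aw_factor_minus [simp]: "aw_factor q e (- t) = aw_factor q e t"
  by (simp add: aw_factor_def)

lemma aw_factor_shift:
  assumes "\<bar>q\<bar> < 1"
  shows "aw_factor q e t = (1 - e * cis t) * (1 - e * cis (- t)) * aw_factor q (e * of_real q) t"
  unfolding aw_factor_def
  by (subst (1 2) qpoch_inf_split_head[OF assms]) (simp add: mult_ac)

lemma continuous_on_aw_factor [continuous_intros]:
  assumes "\<bar>q\<bar> < 1" "continuous_on S f" "continuous_on S g"
  shows "continuous_on S (\<lambda>x. aw_factor q (f x) (g x))"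
  unfolding aw_factor_def using assms by (auto intro!: continuous_intros)

lemma continuous_on_aw_weight [continuous_intros]:
  assumes "\<bar>q\<bar> < 1" "norm b < 1" "norm c < 1" "norm d < 1"
    and "continuous_on S f" "continuous_on S g" "\<And>x. x \<in> S \<Longrightarrow> norm (f x) < 1"
  shows "continuous_on S (\<lambda>x. aw_weight q (f x) b c d (g x))"
  unfolding aw_weight_def using assms by (auto intro!: continuous_intros simp: aw_factor_nonzero)

lemma aw_weight_integrable:
  assumes "\<bar>q\<bar> < 1" "norm a < 1" "norm b < 1" "norm c < 1" "norm d < 1"
  shows "aw_weight q a b c d integrable_on {s..t}"
proof (rule integrable_continuous_interval)
  show "continuous_on {s..t} (aw_weight q a b c d)"
    using assms continuous_on_aw_weight[of q b c d "{s..t}" "\<lambda>_. a" "\<lambda>t. t"]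
    by (simp add: continuous_intros)
qed

definition aw_half :: "real \<Rightarrow> complex \<Rightarrow> complex \<Rightarrow> complex" where
  "aw_half q e z = qpoch_inf (e * z) q * qpoch_inf (of_real q * e / z) q"

definition aw_kernel :: "real \<Rightarrow> complex \<Rightarrow> complex \<Rightarrow> complex \<Rightarrow> complex \<Rightarrow> complex \<Rightarrow> complex" where
  "aw_kernel q a b c d z = z * (qpoch_inf (z ^ 2) q * qpoch_inf (of_real q / z ^ 2) q /
     (aw_half q a z * aw_half q b z * aw_half q c z * aw_half q d z))"

text \<open>
  The map \<open>z \<mapsto> q / z\<close> changes the sign of the kernel and exchanges the circles of radius \<open>1\<close> and \<open>q\<close>,
  between which the kernel is holomorphic; so the integral equals its own negative.
\<close>
lemma aw_kernel_integral_eq_0: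
  fixes a b c d :: complex
  assumes q: "0 < q" "q < 1" and abcd: "norm a < 1" "norm b < 1" "norm c < 1" "norm d < 1"
  shows "integral {-pi..pi} (\<lambda>t. aw_kernel q a b c d (cis t)) = 0"
    and "continuous_on {-pi..pi} (\<lambda>t. aw_kernel q a b c d (cis t))"
proof -
  have aq: "\<bar>q\<bar> < 1"
    using q by simp
  define D where "D = aw_half q"
  define u where "u = aw_kernel q a b c d"
  note Dz = aw_half_def[of q, folded D_def]
  note uz = aw_kernel_def[of q a b c d, folded D_def u_def]
  define f where "f \<equiv> \<lambda>z. qpoch_inf (z ^ 2) q * qpoch_inf (of_real q / z ^ 2) q / (D a z * D b z * D c z * D d z)"
  define m where "m = Max {1/2, norm a, norm b, norm c, norm d}"
  have m: "0 < m" "m < 1" "norm a \<le> m" "norm b \<le> m" "norm c \<le> m" "norm d \<le> m"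
    using abcd by (auto simp: m_def less_max_iff_disj)
  define S where "S = ball (0 :: complex) (1 / m) - cball 0 (q * m)"
  have D0: "D e z \<noteq> 0" if "norm e \<le> m" "z \<in> S" for e z
  proof -
    have "norm (e * z) < 1"
    proof -
      have "norm (e * z) \<le> m * norm z"
        using that by (simp add: norm_mult mult_right_mono)
      also have "\<dots> < 1"
        using that m by (simp add: S_def field_simps)
      finally show ?thesis .
    qed
    moreover have "norm (of_real q * e / z) < 1"
    proof -
      have "norm (of_real q * e) \<le> q * m"
        using that q by (simp add: norm_mult)
      also have "\<dots> < norm z"
        using that by (simp add: S_def)
      finally show ?thesis
        using q m by (simp add: norm_divide divide_less_eq split: if_splits)
    qed
    ultimately show ?thesis
      by (simp add: Dz qpoch_inf_nonzero aq)
  qed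
  have z0: "z \<noteq> 0" if "z \<in> S" for z
    using that q m by (auto simp: S_def)
  have hol: "f holomorphic_on S"
    unfolding f_def using D0 m z0 unfolding Dz
    by (auto intro!: holomorphic_intros aq)
  have sub: "{z. q \<le> norm z \<and> norm z \<le> 1} \<subseteq> S"
  proof
    fix z :: complex assume z: "z \<in> {z. q \<le> norm z \<and> norm z \<le> 1}"
    have "q * m < q" "1 < 1 / m"
      using q m by auto
    with z show "z \<in> S"
      by (auto simp: S_def)
  qed
  have cisS: "cis t \<in> S" for t
    using sub q by auto
  have u_eq: "u z = f z * z" for z
    by (simp add: uz f_def)
  have "continuous_on {-pi..pi} (\<lambda>t. u (cis t))"
    unfolding u_eq
    by (intro continuous_intros continuous_on_compose2[OF holomorphic_on_imp_continuous_on[OF hol]])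
       (use cisS in auto)
  thus "continuous_on {-pi..pi} (\<lambda>t. aw_kernel q a b c d (cis t))"
    by (simp only: u_def)
  have inv: "u (of_real q * cis t) = - u (cis (-t))" for t
  proof -
    define z where "z = cis (-t)"
    have z: "z \<noteq> 0" "cis t = 1 / z"
      by (auto simp: z_def divide_inverse cis_inverse)
    have D: "D e (of_real q * cis t) = D e z" for e
      unfolding Dz z(2) using z(1) q by (simp add: mult_ac)
    have "(of_real q / z\<^sup>2) * (qpoch_inf (of_real q ^ 2 / z ^ 2) q * qpoch_inf (z ^ 2 / of_real q) q)
        = - (qpoch_inf (z ^ 2) q * qpoch_inf (of_real q / z ^ 2) q)"
      using q z
      by (subst qpoch_inf_split_head[OF aq, of "z ^ 2 / of_real q"],
          subst qpoch_inf_split_head[OF aq, of "of_real q / z ^ 2"])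
         (simp add: field_simps power2_eq_square)
    hence "qpoch_inf (of_real q ^ 2 / z ^ 2) q * qpoch_inf (z ^ 2 / of_real q) q
        = - (qpoch_inf (z ^ 2) q * qpoch_inf (of_real q / z ^ 2) q) * (z ^ 2 / of_real q)"
      using q z by (simp add: field_simps)
    moreover have "(of_real q * cis t) ^ 2 = of_real q ^ 2 / z ^ 2"
        "of_real q / (of_real q * cis t) ^ 2 = z ^ 2 / of_real q"
      unfolding z(2) using q by (simp_all add: power_divide power2_eq_square)
    ultimately have "u (of_real q * cis t) = - u z"
      unfolding uz D using z q by (simp add: power2_eq_square)
    thus ?thesis
      by (simp add: z_def)
  qed
  have "integral {-pi..pi} (\<lambda>t. u (cis t)) = integral {-pi..pi} (\<lambda>t. u (of_real q * cis t))"
    using integral_circle_annulus[OF q(1) _ _ hol sub] q unfolding u_eq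
    by (simp add: S_def open_Diff)
  also have "\<dots> = - integral {-pi..pi} (\<lambda>t. u (cis (- t)))"
    by (simp add: inv)
  also have "integral {-pi..pi} (\<lambda>t. u (cis (- t))) = integral {-pi..pi} (\<lambda>t. u (cis t))"
    using Henstock_Kurzweil_Integration.integral_reflect_real[of pi "-pi" "\<lambda>t. u (cis t)"] by simp
  finally show "integral {-pi..pi} (\<lambda>t. aw_kernel q a b c d (cis t)) = 0"
    by (simp add: u_def)
qed

lemma aw_weight_moment:
  fixes a b c d :: complex
  assumes q: "0 < q" "q < 1" and abcd: "norm a < 1" "norm b < 1" "norm c < 1" "norm d < 1"
  shows "integral {0..pi} (\<lambda>t. aw_weight q a b c d t *
    ((1 - a * b * c * d) * (cis t + cis (-t))
      - (a + b + c + d - (a * b * c + a * b * d + a * c * d + b * c * d)))) = 0"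
proof -
  have aq: "\<bar>q\<bar> < 1"
    using q by simp
  define D where "D = aw_half q"
  define u where "u = aw_kernel q a b c d"
  note Dz = aw_half_def[of q, folded D_def]
  note uz = aw_kernel_def[of q a b c d, folded D_def u_def]
  note u = aw_kernel_integral_eq_0[OF assms, folded u_def]
  define w where "w = (\<lambda>t. aw_weight q a b c d t *
    ((1 - a * b * c * d) * (cis t + cis (-t))
      - (a + b + c + d - (a * b * c + a * b * d + a * c * d + b * c * d))))"
  define v where "v = (\<lambda>z::complex. (1 - a / z) * (1 - b / z) * (1 - c / z) * (1 - d / z))"
  have u_weight: "u (cis t) * (1 - cis (-t) ^ 2) = aw_weight q a b c d t * (cis t * v (cis t))" for t
  proof -
    define z where "z = cis t"
    have z: "z \<noteq> 0" "cis (-t) = 1 / z" "cis (2 * t) = z ^ 2" "cis (-2 * t) = 1 / z ^ 2"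
      by (simp_all add: z_def power2_eq_square cis_mult divide_inverse cis_inverse)
    have D: "aw_factor q e t = (1 - e / z) * D e z" for e
      unfolding aw_factor_def Dz z(2) z_def[symmetric]
      by (subst (2) qpoch_inf_split_head[OF aq]) (simp add: mult_ac)
    have "1 - e / z \<noteq> 0" "D e z \<noteq> 0" if "norm e < 1" for e
      using aw_factor_nonzero[OF aq that, of t] by (auto simp: D)
    hence nz: "1 - a / z \<noteq> 0" "1 - b / z \<noteq> 0" "1 - c / z \<noteq> 0" "1 - d / z \<noteq> 0"
      "D a z \<noteq> 0" "D b z \<noteq> 0" "D c z \<noteq> 0" "D d z \<noteq> 0"
      using abcd by blast+
    have P: "qpoch_inf (1 / z ^ 2) q = (1 - 1 / z ^ 2) * qpoch_inf (of_real q / z ^ 2) q"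
      by (subst qpoch_inf_split_head[OF aq]) simp
    have cancel: "z * (p / (Da * Db * Dc * Dd)) * k =
        p * k / (va * Da * (vb * Db) * (vc * Dc) * (vd * Dd)) * (z * (va * vb * vc * vd))"
      if "va \<noteq> 0" "vb \<noteq> 0" "vc \<noteq> 0" "vd \<noteq> 0" "Da \<noteq> 0" "Db \<noteq> 0" "Dc \<noteq> 0" "Dd \<noteq> 0"
      for p k va vb vc vd Da Db Dc Dd :: complex
      using that by (simp add: field_simps)
    show ?thesis
      unfolding z_def[symmetric] aw_weight_def z D P uz v_def power_one_over
      by (subst cancel[OF nz]) (simp add: mult_ac)
  qed
  have sum: "u (cis t) + u (cis (-t)) = w t" for t
  proof (cases "cis t ^ 2 = 1")
    case True
    hence "cis (-t) ^ 2 = 1"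
      by (metis cis_inverse inverse_1 power_inverse)
    with True have "cis (2 * t) = 1"
      by (simp add: power2_eq_square cis_mult)
    with True \<open>cis (-t) ^ 2 = 1\<close> show ?thesis
      by (simp add: uz w_def aw_weight_def qpoch_inf_1[OF aq])
  next
    case False
    define z where "z = cis t"
    define W where "W = aw_weight q a b c d t"
    have z: "z \<noteq> 0" "cis (-t) = 1 / z" "z ^ 2 \<noteq> 1"
      using False by (auto simp: z_def divide_inverse cis_inverse)
    have W: "aw_weight q a b c d (-t) = W"
      by (simp add: W_def aw_weight_def mult_ac)
    have 1: "u z * (1 - 1 / z ^ 2) = W * (z * v z)" "u (1 / z) * (1 - z ^ 2) = W * (1 / z * v (1 / z))"
      using u_weight[of t] u_weight[of "-t"] unfolding W W_def[symmetric] minus_minus z z_def[symmetric]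
      by (simp_all add: power_one_over)
    have nz: "z ^ 2 - 1 \<noteq> 0"
      using z by simp
    have "u z * (z ^ 2 - 1) = W * (z ^ 3 * v z)" "u (1 / z) * (z ^ 2 - 1) = - W * (v (1 / z) / z)"
      using 1 z by (simp_all add: field_simps power2_eq_square power3_eq_cube)
    hence "(u z + u (1 / z)) * (z ^ 2 - 1) = W * (z ^ 3 * v z - v (1 / z) / z)"
      by (simp add: algebra_simps)
    also have "z ^ 3 * v z - v (1 / z) / z = ((1 - a * b * c * d) * (z + 1 / z)
      - (a + b + c + d - (a * b * c + a * b * d + a * c * d + b * c * d))) * (z ^ 2 - 1)"
      unfolding v_def using z(1) by (simp add: field_simps) (simp add: algebra_simps power2_eq_square power3_eq_cube)
    finally show ?thesis
      using nz unfolding w_def z_def[symmetric] z W_def[symmetric] by (simp add: mult_ac)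
  qed
  have int: "(\<lambda>t. u (cis t)) integrable_on {-pi..pi}"
    by (rule integrable_continuous_interval) (rule u(2))
  have int': "(\<lambda>t. u (cis t)) integrable_on {-pi..0}" "(\<lambda>t. u (cis t)) integrable_on {0..pi}"
    by (rule integrable_on_subinterval[OF int]; simp)+
  have "integral {0..pi} w = integral {0..pi} (\<lambda>t. u (cis t)) + integral {0..pi} (\<lambda>t. u (cis (-t)))"
    unfolding sum[symmetric]
    using int' Henstock_Kurzweil_Integration.integrable_reflect_real[where a = "-pi" and b = 0 and f = "\<lambda>t. u (cis t)"]
    by (intro integral_add) auto
  also have "integral {0..pi} (\<lambda>t. u (cis (-t))) = integral {-pi..0} (\<lambda>t. u (cis t))"
    using Henstock_Kurzweil_Integration.integral_reflect_real[of 0 "-pi" "\<lambda>t. u (cis t)"] by simp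
  also have "integral {0..pi} (\<lambda>t. u (cis t)) + \<dots> = integral {-pi..pi} (\<lambda>t. u (cis t))"
    using Henstock_Kurzweil_Integration.integral_combine[of "-pi" 0 pi "\<lambda>t. u (cis t)"] int
    by (simp add: add.commute)
  also have "\<dots> = 0"
    by (rule u(1))
  finally show ?thesis
    by (simp add: w_def)
qed

lemma aw_integral_shift:
  assumes q: "0 < q" "q < 1" and abcd: "norm a < 1" "norm b < 1" "norm c < 1" "norm d < 1"
  shows "(1 - a * b * c * d) * aw_integral q (a * of_real q) b c d =
    (1 - a * b) * (1 - a * c) * (1 - a * d) * aw_integral q a b c d"
proof -
  have aq: "\<bar>q\<bar> < 1"
    using q by simp
  define e4 where "e4 = a * b * c * d"
  define K where "K = a + b + c + d - (a * b * c + a * b * d + a * c * d + b * c * d)"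
  have aq': "norm (a * of_real q) < 1"
    using norm_mult_power_less_one[OF aq abcd(1), of 1] by simp
  have shift: "aw_weight q (a * of_real q) b c d t =
      aw_weight q a b c d t * ((1 - a * cis t) * (1 - a * cis (-t)))" for t
  proof -
    have "(1 - a * cis t) * (1 - a * cis (-t)) \<noteq> 0"
      using aw_factor_nonzero[OF aq abcd(1), of t] unfolding aw_factor_shift[OF aq, of a] by auto
    thus ?thesis
      unfolding aw_weight_def aw_factor_shift[OF aq, of a] by simp
  qed
  have "(1 - e4) * aw_weight q (a * of_real q) b c d t =
     ((1 - a * b) * (1 - a * c) * (1 - a * d)) * aw_weight q a b c d t -
     a * (aw_weight q a b c d t * ((1 - e4) * (cis t + cis (-t)) - K))" for t
  proof -
    have "cis t * cis (-t) = 1"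
      by (simp add: cis_mult)
    hence "(1 - e4) * ((1 - a * cis t) * (1 - a * cis (-t))) =
      (1 - a * b) * (1 - a * c) * (1 - a * d) - a * ((1 - e4) * (cis t + cis (-t)) - K)"
      unfolding e4_def K_def by algebra
    thus ?thesis
      unfolding shift by algebra
  qed
  hence "(1 - e4) * aw_integral q (a * of_real q) b c d =
    integral {0..pi} (\<lambda>t. ((1 - a * b) * (1 - a * c) * (1 - a * d)) * aw_weight q a b c d t -
     a * (aw_weight q a b c d t * ((1 - e4) * (cis t + cis (-t)) - K)))"
    by (simp add: aw_integral_def flip: integral_mult_right)
  also have "\<dots> = integral {0..pi} (\<lambda>t. ((1 - a * b) * (1 - a * c) * (1 - a * d)) * aw_weight q a b c d t) -
     integral {0..pi} (\<lambda>t. a * (aw_weight q a b c d t * ((1 - e4) * (cis t + cis (-t)) - K)))"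
  proof (rule integral_diff; rule integrable_continuous_interval)
    have [continuous_intros]: "continuous_on {0..pi} (aw_weight q a b c d)"
      using continuous_on_aw_weight[OF aq abcd(2-4), of "{0..pi}" "\<lambda>_. a" "\<lambda>t. t"] abcd
      by simp
    show "continuous_on {0..pi} (\<lambda>t. (1 - a * b) * (1 - a * c) * (1 - a * d) * aw_weight q a b c d t)"
      by (intro continuous_intros)
    show "continuous_on {0..pi} (\<lambda>t. a * (aw_weight q a b c d t * ((1 - e4) * (cis t + cis (-t)) - K)))"
      by (intro continuous_intros)
  qed
  also have "\<dots> = (1 - a * b) * (1 - a * c) * (1 - a * d) * aw_integral q a b c d"
    using aw_weight_moment[OF assms] by (simp add: aw_integral_def e4_def K_def)
  finally show ?thesis
    by (simp add: e4_def)
qed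

lemma aw_integral_shift_power:
  assumes q: "0 < q" "q < 1" and abcd: "norm a < 1" "norm b < 1" "norm c < 1" "norm d < 1"
  shows "qpoch (a * b * c * d) q n * aw_integral q (a * of_real q ^ n) b c d =
    qpoch (a * b) q n * qpoch (a * c) q n * qpoch (a * d) q n * aw_integral q a b c d"
proof (induction n)
  case (Suc n)
  have aq: "\<bar>q\<bar> < 1"
    using q by simp
  let ?A = "a * of_real q ^ n"
  have "qpoch (a * b * c * d) q (Suc n) * aw_integral q (a * of_real q ^ Suc n) b c d =
    qpoch (a * b * c * d) q n * ((1 - ?A * b * c * d) * aw_integral q (?A * of_real q) b c d)"
    by (simp add: qpoch_Suc mult_ac)
  also have "\<dots> = ((1 - ?A * b) * (1 - ?A * c) * (1 - ?A * d)) *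
      (qpoch (a * b * c * d) q n * aw_integral q ?A b c d)"
    unfolding aw_integral_shift[OF q norm_mult_power_less_one[OF aq abcd(1)] abcd(2-4)]
    by (simp add: mult_ac)
  also have "\<dots> = qpoch (a * b) q (Suc n) * qpoch (a * c) q (Suc n) * qpoch (a * d) q (Suc n) *
      aw_integral q a b c d"
    unfolding Suc.IH by (simp add: qpoch_Suc mult_ac)
  finally show ?case .
qed simp

lemma aw_integral_eliminate:
  assumes q: "0 < q" "q < 1" and abcd: "norm a < 1" "norm b < 1" "norm c < 1" "norm d < 1"
  shows "qpoch_inf (a * b * c * d) q * aw_integral q 0 b c d =
    qpoch_inf (a * b) q * qpoch_inf (a * c) q * qpoch_inf (a * d) q * aw_integral q a b c d"
proof (rule LIMSEQ_unique)
  have aq: "\<bar>q\<bar> < 1"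
    using q by simp
  have "continuous_on (ball 0 1) (\<lambda>a. integral (cbox 0 pi) (aw_weight q a b c d))"
  proof (rule integral_continuous_on_param)
    show "continuous_on (ball 0 1 \<times> cbox 0 pi) (\<lambda>(a, t). aw_weight q a b c d t)"
      unfolding case_prod_unfold
      using aq abcd by (intro continuous_intros) auto
  qed
  hence "isCont (\<lambda>a. aw_integral q a b c d) 0"
    by (simp add: aw_integral_def continuous_on_eq_continuous_at)
  moreover have "(\<lambda>n. a * of_real q ^ n) \<longlonglongrightarrow> 0"
    using q by (intro tendsto_mult_right_zero LIMSEQ_power_zero) simp
  ultimately have "(\<lambda>n. aw_integral q (a * of_real q ^ n) b c d) \<longlonglongrightarrow> aw_integral q 0 b c d"
    by (rule isCont_tendsto_compose)
  thus "(\<lambda>n. qpoch (a * b * c * d) q n * aw_integral q (a * of_real q ^ n) b c d)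
      \<longlonglongrightarrow> qpoch_inf (a * b * c * d) q * aw_integral q 0 b c d"
    by (intro tendsto_mult qpoch_tendsto_qpoch_inf aq)
  show "(\<lambda>n. qpoch (a * b * c * d) q n * aw_integral q (a * of_real q ^ n) b c d)
      \<longlonglongrightarrow> qpoch_inf (a * b) q * qpoch_inf (a * c) q * qpoch_inf (a * d) q * aw_integral q a b c d"
    unfolding aw_integral_shift_power[OF assms]
    by (intro tendsto_mult tendsto_const qpoch_tendsto_qpoch_inf aq)
qed

lemma aw_integral_rotate: "aw_integral q a b c d = aw_integral q b c d a"
proof -
  have "aw_weight q a b c d = aw_weight q b c d a"
    by (rule ext) (simp add: aw_weight_def mult_ac)
  thus ?thesis
    by (simp add: aw_integral_def)
qed

lemma aw_integral_eq:
  assumes q: "0 < q" "q < 1" and abcd: "norm a < 1" "norm b < 1" "norm c < 1" "norm d < 1"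
  shows "qpoch_inf (a * b * c * d) q * aw_integral q 0 0 0 0 =
    qpoch_inf (a * b) q * qpoch_inf (a * c) q * qpoch_inf (a * d) q *
    qpoch_inf (b * c) q * qpoch_inf (b * d) q * qpoch_inf (c * d) q * aw_integral q a b c d"
proof -
  have "aw_integral q 0 0 0 0 = aw_integral q 0 d 0 0"
    using aw_integral_eliminate[OF q abcd(4), of 0 0 0] aw_integral_rotate[of q 0 d 0 0]
      aw_integral_rotate[of q d 0 0 0]
    by (metis aw_integral_rotate mult_zero_right norm_zero qpoch_inf_0 mult_1 zero_less_one)
  also have "\<dots> = qpoch_inf (c * d) q * aw_integral q 0 c d 0"
    using aw_integral_eliminate[OF q abcd(3,4), of 0 0] aw_integral_rotate[of q 0 c d 0] by simp
  also have "aw_integral q 0 c d 0 = qpoch_inf (b * c) q * qpoch_inf (b * d) q * aw_integral q 0 b c d"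
    using aw_integral_eliminate[OF q abcd(2-4), of 0] aw_integral_rotate[of q 0 b c d] by simp
  finally show ?thesis
    using aw_integral_eliminate[OF assms] by (simp add: mult_ac)
qed

lemma qpoch_inf_quadruple:
  fixes q :: real and A s :: complex
  assumes "\<bar>q\<bar> < 1" "s ^ 2 = of_real q"
  shows "qpoch_inf A q * qpoch_inf (- A) q * (qpoch_inf (A * s) q * qpoch_inf (- (A * s)) q) =
    qpoch_inf (A ^ 2) q"
  using qpoch_inf_mult_even_odd[OF assms(1), of "A ^ 2"]
  by (simp add: qpoch_inf_mult_uminus[OF assms(1)] power_mult_distrib assms(2))

text \<open>
  For the parameters \<open>q, - q, sqrt q, - sqrt q\<close> the weight collapses to a trigonometric polynomial.
\<close>
lemma aw_integral_special:
  assumes q: "0 < q" "q < 1" and s: "s ^ 2 = of_real q" "norm s < 1"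
  shows "aw_integral q (of_real q) (- of_real q) s (- s) = of_real (2 * pi)"
proof -
  have aq: "\<bar>q\<bar> < 1"
    using q by simp
  have ex: "qpoch_inf (of_real q * cis t) q * qpoch_inf (- (of_real q * cis t)) q *
      (qpoch_inf (s * cis t) q * qpoch_inf (- (s * cis t)) q) =
      qpoch_inf (cis (2 * t) * of_real q) q" for t
  proof -
    have "s * cis t * s = of_real q * cis t"
      using s(1) by (simp add: power2_eq_square mult_ac)
    moreover have "(s * cis t) ^ 2 = cis (2 * t) * of_real q"
      unfolding power_mult_distrib s(1) by (simp add: power2_eq_square cis_mult)
    ultimately show ?thesis
      using qpoch_inf_quadruple[OF aq s(1), of "s * cis t"] by (simp only: mult_ac)
  qed
  have weight: "aw_weight q (of_real q) (- of_real q) s (- s) t = of_real (2 - 2 * cos (2 * t))" for t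
  proof -
    let ?P = "qpoch_inf (cis (2 * t) * of_real q) q" and ?M = "qpoch_inf (cis (2 * (- t)) * of_real q) q"
    have "aw_factor q (of_real q) t * aw_factor q (- of_real q) t * aw_factor q s t * aw_factor q (- s) t =
        ?P * ?M"
      unfolding ex[symmetric] by (simp add: aw_factor_def mult_ac)
    moreover have "?P \<noteq> 0" "?M \<noteq> 0"
      using q by (simp_all add: qpoch_inf_nonzero norm_mult)
    ultimately have "aw_weight q (of_real q) (- of_real q) s (- s) t = (1 - cis (2 * t)) * (1 - cis (- 2 * t))"
      unfolding aw_weight_def
      by (subst qpoch_inf_split_head[OF aq, of "cis (2 * t)"],
          subst qpoch_inf_split_head[OF aq, of "cis (- 2 * t)"]) simp
    also have "\<dots> = of_real (2 - 2 * cos (2 * t))"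
      using sin_cos_squared_add[of "2 * t"] by (simp add: complex_eq_iff algebra_simps power2_eq_square)
    finally show ?thesis .
  qed
  have "((\<lambda>t. 2 - 2 * cos (2 * t)) has_integral (2 * pi - sin (2 * pi)) - (2 * 0 - sin (2 * 0))) {0..pi}"
    by (intro fundamental_theorem_of_calculus)
       (auto intro!: derivative_eq_intros simp flip: has_real_derivative_iff_has_vector_derivative)
  hence "((\<lambda>t. complex_of_real (2 - 2 * cos (2 * t))) has_integral of_real (2 * pi)) {0..pi}"
    using has_integral_of_real[of "\<lambda>t. 2 - 2 * cos (2 * t)" "2 * pi" "{0..pi}"] by simp
  moreover have "aw_weight q (of_real q) (- of_real q) s (- s) = (\<lambda>t. of_real (2 - 2 * cos (2 * t)))"
    by (rule ext) (rule weight)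
  ultimately show ?thesis
    unfolding aw_integral_def by (metis integral_unique)
qed

lemma aw_integral_0:
  assumes q: "0 < q" "q < 1"
  shows "aw_integral q 0 0 0 0 * qpoch_inf (of_real q) q = of_real (2 * pi)"
proof -
  have aq: "\<bar>q\<bar> < 1"
    using q by simp
  define Q where "Q = complex_of_real q"
  define s where "s = complex_of_real (sqrt q)"
  have s: "s ^ 2 = of_real q" "norm s < 1"
    using q by (simp_all add: s_def flip: of_real_power)
  have sQ: "s * s = Q"
    using s by (simp add: Q_def power2_eq_square)
  have nQ: "norm Q < 1"
    using q by (simp add: Q_def)
  define E where "E = qpoch_inf (Q * s) q * qpoch_inf (- (Q * s)) q"
  have nz: "qpoch_inf Q q \<noteq> 0" "qpoch_inf (Q ^ 3) q \<noteq> 0" "qpoch_inf (- (Q ^ 2)) q \<noteq> 0"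
    using q by (simp_all add: qpoch_inf_nonzero Q_def norm_power power_less_one_iff)
  have Q3: "qpoch_inf Q q = (1 - Q) * (1 - Q ^ 2) * qpoch_inf (Q ^ 3) q"
    using qpoch_inf_split[OF aq, of Q 2]
    by (simp add: qpoch_Suc numeral_2_eq_2 numeral_3_eq_3 Q_def[symmetric])
  have Qm: "qpoch_inf (- Q) q = (1 + Q) * qpoch_inf (- (Q ^ 2)) q"
    using qpoch_inf_split_head[OF aq, of "- Q"] by (simp add: Q_def power2_eq_square)
  have "qpoch_inf s q * qpoch_inf (- s) q * (qpoch_inf Q q * qpoch_inf (- Q) q) = qpoch_inf Q q"
    using qpoch_inf_quadruple[OF aq s(1), of s] by (simp add: sQ s(1) flip: Q_def)
  moreover have "qpoch_inf s q * qpoch_inf (- s) q = (1 - Q) * E"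
  proof -
    have "qpoch_inf s q = (1 - s) * qpoch_inf (Q * s) q"
        "qpoch_inf (- s) q = (1 + s) * qpoch_inf (- (Q * s)) q"
      using qpoch_inf_split_head[OF aq, of s] qpoch_inf_split_head[OF aq, of "- s"]
      by (simp_all add: Q_def mult.commute)
    moreover have "(1 - s) * (1 + s) = 1 - Q"
      by (simp add: algebra_simps sQ)
    ultimately show ?thesis
      unfolding E_def by algebra
  qed
  ultimately have euler: "(1 - Q) * E * qpoch_inf (- Q) q = 1"
    using nz(1) by (simp add: mult.assoc)
  have "qpoch_inf (Q ^ 3) q * aw_integral q 0 0 0 0 =
     qpoch_inf (- (Q ^ 2)) q * E ^ 2 * qpoch_inf (- Q) q * of_real (2 * pi)"
  proof -
    have eq: "- (Q ^ 2) * s * - s = Q ^ 3" "Q * - Q = - (Q ^ 2)" "s * - s = - Q"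
      unfolding sQ[symmetric] by (simp_all add: power2_eq_square power3_eq_cube mult_ac)
    have n: "norm (- Q) < 1" "norm (- s) < 1"
      using nQ s by simp_all
    show ?thesis
      using aw_integral_eq[OF q nQ n(1) s(2) n(2)]
      unfolding eq aw_integral_special[OF q s, folded Q_def]
      by (simp add: E_def power2_eq_square mult_ac)
  qed
  hence "aw_integral q 0 0 0 0 * qpoch_inf Q q =
     ((1 - Q) * E * ((1 + Q) * qpoch_inf (- (Q ^ 2)) q)) * ((1 - Q) * E * qpoch_inf (- Q) q) * of_real (2 * pi)"
    unfolding Q3 by algebra
  thus ?thesis
    unfolding Qm[symmetric] euler by (simp add: Q_def)
qed

theorem askey_wilson_integral:
  assumes q: "0 < q" "q < 1" and abcd: "norm a < 1" "norm b < 1" "norm c < 1" "norm d < 1"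
  shows "aw_integral q a b c d = of_real (2 * pi) * qpoch_inf (a * b * c * d) q /
    (qpoch_inf (of_real q) q * qpoch_inf (a * b) q * qpoch_inf (a * c) q * qpoch_inf (a * d) q *
     qpoch_inf (b * c) q * qpoch_inf (b * d) q * qpoch_inf (c * d) q)"
proof -
  have aq: "\<bar>q\<bar> < 1"
    using q by simp
  have nz: "qpoch_inf (e * f) q \<noteq> 0" if "norm e < 1" "norm f < 1" for e f
  proof (rule qpoch_inf_nonzero[OF aq])
    show "norm (e * f) < 1"
      using mult_strict_mono'[OF that] by (simp add: norm_mult)
  qed
  have nzq: "qpoch_inf (of_real q) q \<noteq> 0"
    using q by (intro qpoch_inf_nonzero) auto
  have "of_real (2 * pi) * qpoch_inf (a * b * c * d) q = qpoch_inf (of_real q) q *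
    (qpoch_inf (a * b * c * d) q * aw_integral q 0 0 0 0)"
    by (subst aw_integral_0[OF q, symmetric]) (simp only: mult_ac)
  thus ?thesis
    unfolding aw_integral_eq[OF assms] using nz abcd nzq by simp
qed

subsection \<open>Askey--Wilson polynomials\<close>

definition aw_coeff :: "real \<Rightarrow> nat \<Rightarrow> complex \<Rightarrow> complex \<Rightarrow> complex \<Rightarrow> nat \<Rightarrow> complex" where
  "aw_coeff q n e u v k =
     qpoch (of_real q powi (- int n)) q k * qpoch (of_real q powi (int n - 1) * e) q k /
     (qpoch (of_real q) q k * qpoch u q k * qpoch v q k) * of_real q ^ k"

lemma askey_wilson_eq_sum:
  assumes "0 < q" "t \<in> {0..pi}"
  shows "askey_wilson q n t1 t2 t3 t4 (cos t) =
    qpoch (t1 * t2) q n * qpoch (t1 * t3) q n * qpoch (t1 * t4) q n * t1 powi (- int n) *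
    (\<Sum>k\<le>n. aw_coeff q n (t1 * t2 * t3 * t4) (t1 * t3) (t1 * t4) k / qpoch (t1 * t2) q k *
       (qpoch (t1 * cis t) q k * qpoch (t1 * cis (- t)) q k))"
proof -
  have zero: "qpoch (of_real q powi (- int n)) q k = 0" if "k > n" for k
  proof -
    have "1 - complex_of_real q powi (- int n) * of_real q ^ n = 0"
      using assms by (simp add: power_int_minus)
    thus ?thesis
      unfolding qpoch_def using that by (intro prod_zero) auto
  qed
  have t: "arccos (cos t) = t"
    using assms by (simp add: arccos_cos)
  show ?thesis
    unfolding askey_wilson_def qphi_def t Let_def qpochs_def
    by (subst suminf_finite[of "{..n}"])
       (auto simp: zero aw_coeff_def mult_ac intro!: sum.cong)
qed

lemma h_cos:
  assumes "t \<in> {0..pi}"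
  shows "h q (cos t) as = (\<Prod>a\<leftarrow>as. aw_factor q a t)"
proof -
  have "arccos (cos t) = t"
    using assms by (simp add: arccos_cos)
  thus ?thesis
    by (simp add: h_def qpochs_inf_def aw_factor_def Let_def)
qed

lemma aw_factor_split:
  assumes "\<bar>q\<bar> < 1"
  shows "aw_factor q e t =
    qpoch (e * cis t) q k * qpoch (e * cis (- t)) q k * aw_factor q (e * of_real q ^ k) t"
  unfolding aw_factor_def
  by (subst (1 2) qpoch_inf_split[OF assms, of _ k]) (simp add: mult_ac)

lemma w_H_cos_sin:
  assumes "\<bar>q\<bar> < 1" "t \<in> {0..pi}"
  shows "w_H q (cos t) * of_real (sin t) =
    qpoch_inf (of_real q) q * qpoch_inf (cis (2 * t)) q * qpoch_inf (cis (- 2 * t)) q / of_real (2 * pi)"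
proof -
  have t: "arccos (cos t) = t"
    using assms by (simp add: arccos_cos)
  have "1 - (cos t)\<^sup>2 = (sin t)\<^sup>2"
    by (simp add: sin_squared_eq)
  moreover have "sin t \<ge> 0"
    using assms by (simp add: sin_ge_zero)
  ultimately have sq: "sqrt (1 - (cos t)\<^sup>2) = sin t"
    by simp
  show ?thesis
  proof (cases "sin t = 0")
    case True
    hence "cis (2 * t) = 1"
      by (simp add: complex_eq_iff cos_double_sin sin_double)
    with True show ?thesis
      by (simp add: qpoch_inf_1[OF assms(1)])
  next
    case False
    thus ?thesis
      by (simp add: w_H_def t sq Let_def qpochs_inf_def mult_ac)
  qed
qed

lemma aw_integral_conjugate_pair:
  fixes r :: real and t1 t2 :: complex
  assumes q: "0 < q" "q < 1" and r: "\<bar>r\<bar> < 1" and t12: "norm t1 < 1" "norm t2 < 1"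
  shows "qpoch_inf (of_real (r\<^sup>2)) q * (qpoch_inf (of_real q) q / of_real (2 * pi) *
      aw_integral q (of_real r * cis \<theta>) (of_real r * cis (- \<theta>)) (t1 * of_real q ^ k) t2) =
    qpoch_inf (of_real (r\<^sup>2) * t1 * t2) q /
      (qpoch_inf (t1 * t2) q * (aw_factor q (t1 * of_real r) \<theta> * aw_factor q (t2 * of_real r) \<theta>)) *
    (qpoch (t1 * t2) q k / qpoch (of_real (r\<^sup>2) * t1 * t2) q k *
      (qpoch (t1 * of_real r * cis \<theta>) q k * qpoch (t1 * of_real r * cis (- \<theta>)) q k))"
proof -
  have aq: "\<bar>q\<bar> < 1"
    using q by simp
  have nm: "norm (e * f) < 1" if "norm e < 1" "norm f < 1" for e f :: complex
    using mult_strict_mono'[OF that] by (simp add: norm_mult)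
  have nr: "norm (complex_of_real r) < 1" "norm (of_real r * cis \<theta>) < 1" "norm (of_real r * cis (- \<theta>)) < 1"
    using r by (simp_all add: norm_mult)
  have r2: "of_real r * cis \<theta> * (of_real r * cis (- \<theta>)) = of_real (r\<^sup>2)"
    by (simp add: power2_eq_square cis_mult mult_ac)
  have nr2: "norm (complex_of_real (r\<^sup>2)) < 1"
    using nm[OF nr(1) nr(1)] by (simp add: power2_eq_square)
  have nz1: "qpoch_inf (of_real q) q \<noteq> 0" "qpoch_inf (of_real (r\<^sup>2)) q \<noteq> 0"
    by (rule qpoch_inf_nonzero; use q nr2 in simp)+
  have eq: "of_real r * cis \<theta> * (of_real r * cis (- \<theta>)) * (t1 * of_real q ^ k) * t2 =
      of_real (r\<^sup>2) * t1 * t2 * of_real q ^ k"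
    unfolding r2 by (simp add: mult_ac)
  let ?A = "qpoch (t1 * of_real r * cis \<theta>) q k * qpoch (t1 * of_real r * cis (- \<theta>)) q k"
  let ?F1 = "aw_factor q (t1 * of_real r * of_real q ^ k) \<theta>" and ?F2 = "aw_factor q (t2 * of_real r) \<theta>"
  have F1: "aw_factor q (t1 * of_real r) \<theta> = ?A * ?F1"
    by (rule aw_factor_split[OF aq])
  have nzF: "?F2 \<noteq> 0" "?A * ?F1 \<noteq> 0"
    unfolding F1[symmetric] by (intro aw_factor_nonzero nm aq nr t12)+
  have nz2: "qpoch (t1 * t2) q k * qpoch_inf (t1 * t2 * of_real q ^ k) q \<noteq> 0"
    unfolding qpoch_inf_split[OF aq, of "t1 * t2" k, symmetric]
    by (intro qpoch_inf_nonzero nm aq t12)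
  have nz3: "qpoch (of_real (r\<^sup>2) * t1 * t2) q k \<noteq> 0"
    by (intro qpoch_nonzero nm aq t12 nr2)
  have "aw_integral q (of_real r * cis \<theta>) (of_real r * cis (- \<theta>)) (t1 * of_real q ^ k) t2 =
    of_real (2 * pi) * qpoch_inf (of_real (r\<^sup>2) * t1 * t2 * of_real q ^ k) q /
    (qpoch_inf (of_real q) q * qpoch_inf (of_real (r\<^sup>2)) q * qpoch_inf (t1 * t2 * of_real q ^ k) q *
     ?F1 * ?F2)"
    unfolding askey_wilson_integral[OF q nr(2,3) norm_mult_power_less_one[OF aq t12(1)] t12(2)] eq r2
    by (simp add: aw_factor_def mult_ac)
  hence "qpoch_inf (of_real (r\<^sup>2)) q * (qpoch_inf (of_real q) q / of_real (2 * pi) *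
      aw_integral q (of_real r * cis \<theta>) (of_real r * cis (- \<theta>)) (t1 * of_real q ^ k) t2) =
    qpoch_inf (of_real (r\<^sup>2) * t1 * t2 * of_real q ^ k) q / (qpoch_inf (t1 * t2 * of_real q ^ k) q * ?F1 * ?F2)"
    using nz1 by simp
  thus ?thesis
    using nzF nz2 nz3
    unfolding F1 qpoch_inf_split[OF aq, of "t1 * t2" k] qpoch_inf_split[OF aq, of "of_real (r\<^sup>2) * t1 * t2" k]
    by (simp add: mult_ac)
qed

theorem theorem7p2:
  fixes q r x :: real and t1 t2 t3 t4 :: complex and n :: nat
  assumes "0 < q" and "q < 1"
    and "-1 < r" and "r < 1" and "r \<noteq> 0"
    and "norm t1 < 1" and "norm t2 < 1"
    and "x \<in> {-1..1}"
  shows "T_op q t1 t2 r (askey_wilson q n t1 t2 t3 t4) x =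
    h q x [t1, t2] * qpoch_inf (of_real (r\<^sup>2) * t1 * t2 * of_real q ^ n) q /
    (h q x [t1 * of_real r, t2 * of_real r] * qpoch_inf (t1 * t2 * of_real q ^ n) q) *
    askey_wilson q n (t1 * of_real r) (t2 * of_real r) (t3 / of_real r) (t4 / of_real r) x *
    of_real r ^ n"
proof -
  have q: "0 < q" "q < 1" and aq: "\<bar>q\<bar> < 1" and r: "\<bar>r\<bar> < 1" and t12: "norm t1 < 1" "norm t2 < 1"
    using assms by auto
  have nm: "norm (e * f) < 1" if "norm e < 1" "norm f < 1" for e f :: complex
    using mult_strict_mono'[OF that] by (simp add: norm_mult)
  define \<theta> where "\<theta> = arccos x"
  have \<theta>: "\<theta> \<in> {0..pi}" "x = cos \<theta>"
    using assms by (auto simp: \<theta>_def arccos_lbound arccos_ubound)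
  define a where "a = of_real r * cis \<theta>"
  define b where "b = of_real r * cis (- \<theta>)"
  have ab: "norm a < 1" "norm b < 1"
    using r by (simp_all add: a_def b_def norm_mult)
  define C where "C = aw_coeff q n (t1 * t2 * t3 * t4) (t1 * t3) (t1 * t4)"
  define R where "R = of_real (r\<^sup>2) * t1 * t2"
  define P where "P = qpoch (t1 * t3) q n * qpoch (t1 * t4) q n * t1 powi (- int n)"
  define F where "F = aw_factor q (t1 * of_real r) \<theta> * aw_factor q (t2 * of_real r) \<theta>"
  define S where "S = (\<Sum>k\<le>n. C k / qpoch R q k *
    (qpoch (t1 * of_real r * cis \<theta>) q k * qpoch (t1 * of_real r * cis (- \<theta>)) q k))"
  have nzt: "qpoch (t1 * t2) q k \<noteq> 0" for k
    by (intro qpoch_nonzero nm aq t12)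
  have nm_k: "norm (t1 * of_real q ^ k) < 1" for k
    by (rule norm_mult_power_less_one[OF aq t12(1)])
  have integrand: "w_H q (cos t) * askey_wilson q n t1 t2 t3 t4 (cos t) * of_real (sin t) /
      (h q (cos t) [a, b] * h q (cos t) [t1, t2]) =
    (\<Sum>k\<le>n. qpoch (t1 * t2) q n * P * (C k / qpoch (t1 * t2) q k) *
       (qpoch_inf (of_real q) q / of_real (2 * pi)) * aw_weight q a b (t1 * of_real q ^ k) t2 t)"
    if t: "t \<in> {0..pi}" for t
  proof -
    define w where "w = w_H q (cos t) * of_real (sin t)"
    define N where "N = (\<lambda>k. qpoch (t1 * cis t) q k * qpoch (t1 * cis (- t)) q k)"
    have weight: "w * N k / (aw_factor q a t * aw_factor q b t * (aw_factor q t1 t * aw_factor q t2 t)) =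
        qpoch_inf (of_real q) q / of_real (2 * pi) * aw_weight q a b (t1 * of_real q ^ k) t2 t" for k
    proof -
      have N: "aw_factor q t1 t = N k * aw_factor q (t1 * of_real q ^ k) t"
        unfolding N_def by (rule aw_factor_split[OF aq])
      have "N k \<noteq> 0"
        using aw_factor_nonzero[OF aq t12(1), of t] by (auto simp: N)
      thus ?thesis
        unfolding N w_def w_H_cos_sin[OF aq t] aw_weight_def by (simp add: mult_ac)
    qed
    have "w_H q (cos t) * askey_wilson q n t1 t2 t3 t4 (cos t) * of_real (sin t) /
        (h q (cos t) [a, b] * h q (cos t) [t1, t2]) =
      w * (qpoch (t1 * t2) q n * P * (\<Sum>k\<le>n. C k / qpoch (t1 * t2) q k * N k)) /
        (aw_factor q a t * aw_factor q b t * (aw_factor q t1 t * aw_factor q t2 t))"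
      by (simp add: askey_wilson_eq_sum[OF q(1) t] h_cos[OF t] w_def P_def C_def N_def mult_ac)
    also have "\<dots> = (\<Sum>k\<le>n. qpoch (t1 * t2) q n * P * (C k / qpoch (t1 * t2) q k) *
        (w * N k / (aw_factor q a t * aw_factor q b t * (aw_factor q t1 t * aw_factor q t2 t))))"
      by (simp add: sum_distrib_left sum_divide_distrib mult_ac)
    finally show ?thesis
      unfolding weight by (simp add: mult_ac)
  qed
  have "T_op q t1 t2 r (askey_wilson q n t1 t2 t3 t4) x = h q x [t1, t2] * qpoch_inf (of_real (r\<^sup>2)) q *
    integral {0..pi} (\<lambda>t. \<Sum>k\<le>n. qpoch (t1 * t2) q n * P * (C k / qpoch (t1 * t2) q k) *
       (qpoch_inf (of_real q) q / of_real (2 * pi)) * aw_weight q a b (t1 * of_real q ^ k) t2 t)"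
    unfolding T_op_def \<theta>_def[symmetric] Let_def a_def[symmetric] b_def[symmetric]
    by (subst Henstock_Kurzweil_Integration.integral_cong[OF integrand]) (assumption, rule refl)
  also have "integral {0..pi} (\<lambda>t. \<Sum>k\<le>n. qpoch (t1 * t2) q n * P * (C k / qpoch (t1 * t2) q k) *
       (qpoch_inf (of_real q) q / of_real (2 * pi)) * aw_weight q a b (t1 * of_real q ^ k) t2 t) =
     (\<Sum>k\<le>n. qpoch (t1 * t2) q n * P * (C k / qpoch (t1 * t2) q k) *
       (qpoch_inf (of_real q) q / of_real (2 * pi)) * aw_integral q a b (t1 * of_real q ^ k) t2)"
  proof -
    have "(\<lambda>t. C' k * aw_weight q a b (t1 * of_real q ^ k) t2 t) integrable_on {0..pi}" for C' k
      by (intro integrable_on_mult_right aw_weight_integrable aq ab nm_k t12)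
    thus ?thesis
      unfolding aw_integral_def
      by (subst integral_sum) (simp_all only: finite_atMost Henstock_Kurzweil_Integration.integral_mult_right)
  qed
  also have "h q x [t1, t2] * qpoch_inf (of_real (r\<^sup>2)) q * \<dots> = h q x [t1, t2] * (\<Sum>k\<le>n.
      qpoch (t1 * t2) q n * P * (C k / qpoch (t1 * t2) q k) * (qpoch_inf (of_real (r\<^sup>2)) q *
        (qpoch_inf (of_real q) q / of_real (2 * pi) * aw_integral q a b (t1 * of_real q ^ k) t2)))"
    by (simp add: sum_distrib_left mult_ac)
  also have "\<dots> = h q x [t1, t2] * (\<Sum>k\<le>n.
      (qpoch (t1 * t2) q n * P * (qpoch_inf R q / (qpoch_inf (t1 * t2) q * F))) *
      (C k / qpoch R q k * (qpoch (t1 * of_real r * cis \<theta>) q k * qpoch (t1 * of_real r * cis (- \<theta>)) q k)))"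
  proof (intro arg_cong[where f = "\<lambda>z. h q x [t1, t2] * z"] sum.cong refl)
    fix k
    show "qpoch (t1 * t2) q n * P * (C k / qpoch (t1 * t2) q k) * (qpoch_inf (of_real (r\<^sup>2)) q *
        (qpoch_inf (of_real q) q / of_real (2 * pi) * aw_integral q a b (t1 * of_real q ^ k) t2)) =
      (qpoch (t1 * t2) q n * P * (qpoch_inf R q / (qpoch_inf (t1 * t2) q * F))) *
      (C k / qpoch R q k * (qpoch (t1 * of_real r * cis \<theta>) q k * qpoch (t1 * of_real r * cis (- \<theta>)) q k))"
      unfolding a_def b_def aw_integral_conjugate_pair[OF q r t12] R_def[symmetric] F_def[symmetric]
      using nzt[of k] by simp
  qed
  also have "\<dots> = h q x [t1, t2] * (qpoch (t1 * t2) q n * P * (qpoch_inf R q / (qpoch_inf (t1 * t2) q * F)) * S)"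
    by (simp only: S_def sum_distrib_left)
  also have "\<dots> = h q x [t1, t2] * qpoch_inf (R * of_real q ^ n) q / (F * qpoch_inf (t1 * t2 * of_real q ^ n) q) *
      (qpoch R q n * P * S)"
    using nzt[of n]
    by (subst qpoch_inf_split[OF aq, of R n], subst qpoch_inf_split[OF aq, of "t1 * t2" n])
       (simp add: mult_ac)
  also have "qpoch R q n * P * S =
    askey_wilson q n (t1 * of_real r) (t2 * of_real r) (t3 / of_real r) (t4 / of_real r) x * of_real r ^ n"
  proof -
    have par: "t1 * of_real r * (t2 * of_real r) = R"
        "t1 * of_real r * (t3 / of_real r) = t1 * t3" "t1 * of_real r * (t4 / of_real r) = t1 * t4"
        "R * (t3 / of_real r) * (t4 / of_real r) = t1 * t2 * t3 * t4"
      using assms(5) by (simp_all add: R_def power2_eq_square)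
    have "(t1 * of_real r) powi (- int n) * of_real r ^ n = t1 powi (- int n)"
      using assms(5) by (simp add: power_int_minus power_mult_distrib)
    thus ?thesis
      unfolding \<theta>(2) askey_wilson_eq_sum[OF q(1) \<theta>(1)] par C_def[symmetric] S_def[symmetric] P_def
      by (simp add: mult_ac flip: \<open>_ = t1 powi (- int n)\<close>)
  qed
  also have "F = h q x [t1 * of_real r, t2 * of_real r]"
    unfolding \<theta>(2) by (simp add: h_cos[OF \<theta>(1)] F_def)
  finally show ?thesis
    by (simp add: R_def mult_ac)
qed

end
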